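(* Let $(\omega^1,\omega^2,\omega^3)$ be a coframing of a 3-manifold $M$ satisfying $$\begin{aligned} d\omega^1&=A_2\,\omega^1\wedge\omega^2+(A_3-C)\,\omega^1\wedge\omega^3+\omega^2\wedge\omega^3,\\ d\omega^2&=-A_1\,\omega^1\wedge\omega^2+\epsilon\,\omega^1\wedge\omega^3+(A_3+C)\,\omega^2\wedge\omega^3,\\ d\omega^3&=\delta\sin(\zeta)\,\omega^1\wedge\omega^3+\cos(\zeta)\,\omega^2\wedge\omega^3,\\ dC&=C_3\,\omega^3,\end{aligned}$$ with $\epsilon,\delta\in\{\pm1\}$, $C_3\neq0$ and $dC\wedge dC_3\neq0$, and give $M$ the Riemannian metric $g=(\omega^1)^2+(\omega^2)^2+(\omega^3)^2$. Then each leaf of the foliation defined by $\omega^3$ has mean curvature $H=A_3$ and Gauss curvature $K=A_3^2-C^2-\tfrac12(1+\epsilon)$.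
   Context: The coframing is an adapted coframe of a bi-contact structure $(\omega^1,\omega^2)$ (a pair of contact 1-forms with distinct kernels at each point of an orientable 3-manifold), with $C$ the invariant function given by $\omega^1\wedge d\omega^2+\omega^2\wedge d\omega^1=2C\,\omega^1\wedge\omega^2\wedge\omega^3$; $A_1,A_2,A_3,\zeta,C_3$ are functions on $M$. The leaves are the integral surfaces of $\omega^3$. The Levi-Civita connection forms of $g$ are $\omega^i_j=-\omega^j_i=\Gamma^i_{jk}\omega^k$ with $d\omega^i=-\omega^i_j\wedge\omega^j$. For a leaf $\iota:\Sigma\hookrightarrow M$ the second fundamental form is $\sum_{i,j\le2}\Gamma^3_{ij}\,\bar\omega^i\bar\omega^j$ with $\bar\omega^i=\iota^*\omega^i$ and matrix $S_\Sigma=[\Gamma^3_{ij}]_{i,j\le2}$; the mean curvature is $H=\Gamma^3_{11}+\Gamma^3_{22}$; and the curvature 2-form of the leaf is $\iota^*(d\omega^1_2)=\iota^*(\Theta^1_2)-\det(S_\Sigma)\,\bar\omega^1\wedge\bar\omega^2$, where $\Theta^1_2=d\omega^1_2+\omega^3_1\wedge\omega^3_2$.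
   Formalization: Mean curvature is taken as half of Γ³₁₁+Γ³₂₂ (the sum itself equals 2A₃, so H=A₃ fails for it), and Gauss curvature as det S_Σ, the product of the principal curvatures, since the stated formula is false for the intrinsic curvature of the leaves. *)

theory Defs
  imports "HOL-Analysis.Analysis"
begin

fun C_k_on :: "nat \<Rightarrow> 'a::real_normed_vector set \<Rightarrow> ('a \<Rightarrow> 'b::real_normed_vector) \<Rightarrow> bool" where
  "C_k_on 0 S f \<longleftrightarrow> continuous_on S f"
| "C_k_on (Suc k) S f \<longleftrightarrow>
     (\<forall>x\<in>S. f differentiable (at x)) \<and> (\<forall>v. C_k_on k S (\<lambda>x. frechet_derivative f (at x) v))"

text \<open>Only used for open subsets \<open>S\<close> of Euclidean spaces, where this is the usual class of
  \<open>C\<^sup>\<infinity>\<close> maps.\<close>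

definition smooth_on :: "'a::real_normed_vector set \<Rightarrow> ('a \<Rightarrow> 'b::real_normed_vector) \<Rightarrow> bool" where
  "smooth_on S f \<longleftrightarrow> (\<forall>k. C_k_on k S f)"

type_synonym ('m, 'e) chart = "'m set \<times> ('m \<Rightarrow> 'e)"

definition chart_inv :: "('m, 'e) chart \<Rightarrow> 'e \<Rightarrow> 'm" where
  "chart_inv c = inv_into (fst c) (snd c)"

text \<open>The dimension of the manifold is the dimension of the model space \<open>'e\<close>.\<close>

definition smooth_manifold :: "'m topology \<Rightarrow> ('m, 'e::euclidean_space) chart set \<Rightarrow> bool" where
  "smooth_manifold X atl \<longleftrightarrow>
     Hausdorff_space X \<and> second_countable X \<and>
     (\<Union>c\<in>atl. fst c) = topspace X \<and>
     (\<forall>c\<in>atl. openin X (fst c) \<and> open (snd c ` fst c) \<and>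
        homeomorphic_map (subtopology X (fst c)) (top_of_set (snd c ` fst c)) (snd c)) \<and>
     (\<forall>c\<in>atl. \<forall>c'\<in>atl. smooth_on (snd c ` (fst c \<inter> fst c')) (snd c' \<circ> chart_inv c))"

definition smooth_fun :: "('m, 'e::euclidean_space) chart set \<Rightarrow> ('m \<Rightarrow> real) \<Rightarrow> bool" where
  "smooth_fun atl f \<longleftrightarrow> (\<forall>c\<in>atl. smooth_on (snd c ` fst c) (f \<circ> chart_inv c))"

text \<open>A tensor field is given by its expressions in the charts: \<open>\<alpha> c p v\<close> is the value of
  \<open>\<alpha>\<close> at \<open>p\<close> on the tangent vector whose components in the chart \<open>c\<close> around \<open>p\<close> are \<open>v\<close>. Values
  for \<open>p\<close> outside the domain \<open>fst c\<close> are irrelevant.\<close>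

type_synonym ('m, 'e) form1 = "('m, 'e) chart \<Rightarrow> 'm \<Rightarrow> 'e \<Rightarrow> real"
type_synonym ('m, 'e) form2 = "('m, 'e) chart \<Rightarrow> 'm \<Rightarrow> 'e \<Rightarrow> 'e \<Rightarrow> real"

definition one_form :: "('m, 'e::euclidean_space) chart set \<Rightarrow> ('m, 'e) form1 \<Rightarrow> bool" where
  "one_form atl \<alpha> \<longleftrightarrow>
     (\<forall>c\<in>atl. \<forall>p\<in>fst c. linear (\<alpha> c p)) \<and>
     (\<forall>c\<in>atl. \<forall>v. smooth_on (snd c ` fst c) (\<lambda>x. \<alpha> c (chart_inv c x) v)) \<and>
     (\<forall>c\<in>atl. \<forall>c'\<in>atl. \<forall>p\<in>fst c \<inter> fst c'. \<forall>v.
        \<alpha> c p v = \<alpha> c' p (frechet_derivative (snd c' \<circ> chart_inv c) (at (snd c p)) v))"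

definition wedge :: "('m, 'e) form1 \<Rightarrow> ('m, 'e) form1 \<Rightarrow> ('m, 'e) form2"  (infixl "\<and>\<^sub>w" 75) where
  "(\<alpha> \<and>\<^sub>w \<beta>) c p u v = \<alpha> c p u * \<beta> c p v - \<alpha> c p v * \<beta> c p u"

definition d_fun :: "('m \<Rightarrow> real) \<Rightarrow> ('m, 'e::euclidean_space) form1" where
  "d_fun f c p v = frechet_derivative (f \<circ> chart_inv c) (at (snd c p)) v"

definition d_form :: "('m, 'e::euclidean_space) form1 \<Rightarrow> ('m, 'e) form2" where
  "d_form \<alpha> c p u v =
     frechet_derivative (\<lambda>x. \<alpha> c (chart_inv c x) v) (at (snd c p)) u -
     frechet_derivative (\<lambda>x. \<alpha> c (chart_inv c x) u) (at (snd c p)) v"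

definition coframing :: "('m, real^3) chart set \<Rightarrow> (3 \<Rightarrow> ('m, real^3) form1) \<Rightarrow> bool" where
  "coframing atl \<omega> \<longleftrightarrow>
     (\<forall>i. one_form atl (\<omega> i)) \<and>
     (\<forall>c\<in>atl. \<forall>p\<in>fst c. \<forall>a::3 \<Rightarrow> real. (\<forall>v. (\<Sum>i\<in>UNIV. a i * \<omega> i c p v) = 0) \<longrightarrow> (\<forall>i. a i = 0))"

definition coframe_metric :: "(3 \<Rightarrow> ('m, 'e) form1) \<Rightarrow> ('m, 'e) form2" where
  "coframe_metric \<omega> c p u v = (\<Sum>i\<in>UNIV. \<omega> i c p u * \<omega> i c p v)"

text \<open>The functions \<open>\<Gamma> i j k\<close> are the components of the connection form \<open>\<omega>\<^sup>i\<^sub>j\<close> in the coframing.\<close>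

definition connection_form ::
  "(3 \<Rightarrow> ('m, 'e) form1) \<Rightarrow> (3 \<Rightarrow> 3 \<Rightarrow> 3 \<Rightarrow> 'm \<Rightarrow> real) \<Rightarrow> 3 \<Rightarrow> 3 \<Rightarrow> ('m, 'e) form1" where
  "connection_form \<omega> \<Gamma> i j c p v = (\<Sum>k\<in>UNIV. \<Gamma> i j k p * \<omega> k c p v)"

text \<open>Connection forms of the metric \<open>g\<close> in the \<open>g\<close>-orthonormal coframing \<open>\<omega>\<close>: they are
  skew-symmetric (compatibility with \<open>g\<close>) and satisfy the first structure equation (no torsion).\<close>

definition Levi_Civita_coefficients ::
  "('m, real^3) chart set \<Rightarrow> ('m, real^3) form2 \<Rightarrow> (3 \<Rightarrow> ('m, real^3) form1) \<Rightarrow>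
   (3 \<Rightarrow> 3 \<Rightarrow> 3 \<Rightarrow> 'm \<Rightarrow> real) \<Rightarrow> bool" where
  "Levi_Civita_coefficients atl g \<omega> \<Gamma> \<longleftrightarrow>
     (\<forall>c\<in>atl. \<forall>p\<in>fst c. \<forall>u v. g c p u v = coframe_metric \<omega> c p u v) \<and>
     (\<forall>c\<in>atl. \<forall>p\<in>fst c. \<forall>i j v.
        connection_form \<omega> \<Gamma> i j c p v = - connection_form \<omega> \<Gamma> j i c p v) \<and>
     (\<forall>c\<in>atl. \<forall>p\<in>fst c. \<forall>i u v.
        d_form (\<omega> i) c p u v = - (\<Sum>j\<in>UNIV. (connection_form \<omega> \<Gamma> i j \<and>\<^sub>w \<omega> j) c p u v))"

definition local_rep ::
  "('s, 'f) chart \<Rightarrow> ('m, 'e) chart \<Rightarrow> ('s \<Rightarrow> 'm) \<Rightarrow> 'f \<Rightarrow> 'e" where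
  "local_rep b c \<iota> = snd c \<circ> \<iota> \<circ> chart_inv b"

definition immersion ::
  "'s topology \<Rightarrow> ('s, 'f::euclidean_space) chart set \<Rightarrow>
   'm topology \<Rightarrow> ('m, 'e::euclidean_space) chart set \<Rightarrow> ('s \<Rightarrow> 'm) \<Rightarrow> bool" where
  "immersion Y btl X atl \<iota> \<longleftrightarrow>
     continuous_map Y X \<iota> \<and>
     (\<forall>b\<in>btl. \<forall>c\<in>atl.
        smooth_on (snd b ` {p \<in> fst b. \<iota> p \<in> fst c}) (local_rep b c \<iota>) \<and>
        (\<forall>p\<in>fst b. \<iota> p \<in> fst c \<longrightarrow>
           inj (frechet_derivative (local_rep b c \<iota>) (at (snd b p)))))"

definition chart_at :: "('m, 'e) chart set \<Rightarrow> 'm \<Rightarrow> ('m, 'e) chart" where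
  "chart_at atl p = (SOME c. c \<in> atl \<and> p \<in> fst c)"

text \<open>For a \<open>one_form\<close> the pullback does not depend on the chart chosen around \<open>\<iota> p\<close>.\<close>

definition pullback ::
  "('m, 'e::euclidean_space) chart set \<Rightarrow> ('s \<Rightarrow> 'm) \<Rightarrow> ('m, 'e) form1 \<Rightarrow>
   ('s, 'f::euclidean_space) form1" where
  "pullback atl \<iota> \<alpha> b p v =
     (let c = chart_at atl (\<iota> p)
      in \<alpha> c (\<iota> p) (frechet_derivative (local_rep b c \<iota>) (at (snd b p)) v))"

text \<open>The leaves of the foliation defined by \<open>\<alpha>\<close> are its maximal integral surfaces; maximality
  is not imposed here.\<close>

definition integral_surface ::
  "'m topology \<Rightarrow> ('m, real^3) chart set \<Rightarrow> ('m, real^3) form1 \<Rightarrow>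
   's topology \<Rightarrow> ('s, real^2) chart set \<Rightarrow> ('s \<Rightarrow> 'm) \<Rightarrow> bool" where
  "integral_surface X atl \<alpha> Y btl \<iota> \<longleftrightarrow>
     smooth_manifold Y btl \<and> connected_space Y \<and>
     immersion Y btl X atl \<iota> \<and> inj_on \<iota> (topspace Y) \<and>
     (\<forall>b\<in>btl. \<forall>p\<in>fst b. \<forall>v. pullback atl \<iota> \<alpha> b p v = 0)"

text \<open>The indices 1, 2 of the type \<open>2\<close>, in which 2 = 0, as indices of the type \<open>3\<close>.\<close>

definition tang :: "2 \<Rightarrow> 3" where
  "tang i = (if i = 1 then 1 else 2)"

definition second_fundamental_form ::
  "('m, real^3) chart set \<Rightarrow> (3 \<Rightarrow> ('m, real^3) form1) \<Rightarrow> (3 \<Rightarrow> 3 \<Rightarrow> 3 \<Rightarrow> 'm \<Rightarrow> real) \<Rightarrow>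
   ('s \<Rightarrow> 'm) \<Rightarrow> ('s, real^2) form2" where
  "second_fundamental_form atl \<omega> \<Gamma> \<iota> b p u v =
     (\<Sum>i\<in>UNIV. \<Sum>j\<in>UNIV. \<Gamma> 3 (tang i) (tang j) (\<iota> p) *
        pullback atl \<iota> (\<omega> (tang i)) b p u * pullback atl \<iota> (\<omega> (tang j)) b p v)"

text \<open>The matrix of the second fundamental form in the orthonormal coframing
  \<open>(\<iota>\<^sup>*\<omega>\<^sup>1, \<iota>\<^sup>*\<omega>\<^sup>2)\<close> of the surface.\<close>

definition shape_matrix ::
  "('m, real^3) chart set \<Rightarrow> (3 \<Rightarrow> ('m, real^3) form1) \<Rightarrow> (3 \<Rightarrow> 3 \<Rightarrow> 3 \<Rightarrow> 'm \<Rightarrow> real) \<Rightarrow>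
   ('s, real^2) chart set \<Rightarrow> ('s \<Rightarrow> 'm) \<Rightarrow> 's \<Rightarrow> real^2^2" where
  "shape_matrix atl \<omega> \<Gamma> btl \<iota> p =
     (THE S. \<forall>b\<in>btl. p \<in> fst b \<longrightarrow> (\<forall>u v.
        second_fundamental_form atl \<omega> \<Gamma> \<iota> b p u v =
        (\<Sum>i\<in>UNIV. \<Sum>j\<in>UNIV. S $ i $ j *
           pullback atl \<iota> (\<omega> (tang i)) b p u * pullback atl \<iota> (\<omega> (tang j)) b p v)))"

text \<open>The mean curvature is normalised as the average of the principal curvatures. With the other
  common normalisation, their sum, it would be twice as large.\<close>

definition mean_curvature ::
  "('m, real^3) chart set \<Rightarrow> (3 \<Rightarrow> ('m, real^3) form1) \<Rightarrow> (3 \<Rightarrow> 3 \<Rightarrow> 3 \<Rightarrow> 'm \<Rightarrow> real) \<Rightarrow>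
   ('s, real^2) chart set \<Rightarrow> ('s \<Rightarrow> 'm) \<Rightarrow> 's \<Rightarrow> real" where
  "mean_curvature atl \<omega> \<Gamma> btl \<iota> p = trace (shape_matrix atl \<omega> \<Gamma> btl \<iota> p) / 2"

text \<open>The Gauss (Gauss-Kronecker) curvature is the product of the principal curvatures. As
  the ambient manifold is curved, it differs in general from the curvature of the induced metric.\<close>

definition Gauss_curvature ::
  "('m, real^3) chart set \<Rightarrow> (3 \<Rightarrow> ('m, real^3) form1) \<Rightarrow> (3 \<Rightarrow> 3 \<Rightarrow> 3 \<Rightarrow> 'm \<Rightarrow> real) \<Rightarrow>
   ('s, real^2) chart set \<Rightarrow> ('s \<Rightarrow> 'm) \<Rightarrow> 's \<Rightarrow> real" where
  "Gauss_curvature atl \<omega> \<Gamma> btl \<iota> p = det (shape_matrix atl \<omega> \<Gamma> btl \<iota> p)"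

end

theory Submission
  imports Defs
begin

text \<open>The components \<open>\<Gamma>\<^sup>3\<^sub>i\<^sub>j\<close> with \<open>i, j \<le> 2\<close> are read off by comparing coefficients of
  \<open>\<omega>\<^sup>i \<and> \<omega>\<^sup>j\<close> in the structure equations: \<open>d\<omega>\<^sup>1\<close> and \<open>d\<omega>\<^sup>2\<close> give the diagonal entries \<open>A\<^sub>3 - C\<close> and
  \<open>A\<^sub>3 + C\<close> and, after elimination of \<open>\<Gamma>\<^sup>1\<^sub>2\<^sub>3\<close>, the sum \<open>1 + \<epsilon>\<close> of the off-diagonal entries, which are
  equal because \<open>d\<omega>\<^sup>3\<close> has no \<open>\<omega>\<^sup>1 \<and> \<omega>\<^sup>2\<close> term. Finally \<open>(1 + \<epsilon>)\<^sup>2 / 4 = (1 + \<epsilon>) / 2\<close> since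
  \<open>\<epsilon> = \<plusminus>1\<close>.\<close>

text \<open>A proper subspace lies in a hyperplane; the coordinates of a normal vector of that
  hyperplane would be a nontrivial linear relation among the \<open>f i\<close>.\<close>

lemma independent_functionals_surj:
  fixes f :: "'n::finite \<Rightarrow> 'a::euclidean_space \<Rightarrow> real"
  assumes lin: "\<And>i. linear (f i)"
    and indep: "\<And>a::'n \<Rightarrow> real. (\<And>v. (\<Sum>i\<in>UNIV. a i * f i v) = 0) \<Longrightarrow> a = (\<lambda>i. 0)"
  shows "surj (\<lambda>v. \<chi> i. f i v)"
proof (rule ccontr)
  let ?F = "\<lambda>v. \<chi> i. f i v"
  assume "\<not> surj ?F"
  have "linear ?F"
    using lin by (intro linearI) (auto simp: vec_eq_iff linear_add linear_cmul)
  then have "span (range ?F) = range ?F"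
    by (simp add: linear_subspace_image)
  with \<open>\<not> surj ?F\<close> obtain a where "a \<noteq> 0" "range ?F \<subseteq> {x. a \<bullet> x = 0}"
    using span_not_univ_subset_hyperplane[of "range ?F"] by metis
  then have a: "a \<bullet> ?F v = 0" for v
    by blast
  have "(\<lambda>i. a $ i) = (\<lambda>i. 0)"
    using a by (intro indep) (simp add: inner_vec_def)
  with \<open>a \<noteq> 0\<close> show False
    by (simp add: vec_eq_iff fun_eq_iff)
qed

lemma coframing_surj:
  assumes "coframing atl \<omega>" "c \<in> atl" "q \<in> fst c"
  shows "linear (\<lambda>v. \<chi> i. \<omega> i c q v)" "surj (\<lambda>v. \<chi> i. \<omega> i c q v)"
proof -
  have lin: "linear (\<omega> i c q)" for i
    using assms by (auto simp: coframing_def one_form_def)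
  then show "linear (\<lambda>v. \<chi> i. \<omega> i c q v)"
    by (intro linearI) (auto simp: vec_eq_iff linear_add linear_cmul)
  show "surj (\<lambda>v. \<chi> i. \<omega> i c q v)"
    using assms by (intro independent_functionals_surj lin) (auto simp: coframing_def)
qed

text \<open>On the dual frame \<open>e\<close>, a 2-form takes as values its coefficients in the
  coframing, so structure equations turn into equations between numbers.\<close>

lemma coframing_dual_vector:
  assumes "coframing atl \<omega>" "c \<in> atl" "q \<in> fst c"
  obtains e where "\<And>i j. \<omega> i c q (e j) = (if i = j then 1 else 0)"
proof -
  let ?W = "\<lambda>v. \<chi> i. \<omega> i c q v"
  have "?W (inv ?W (axis j 1)) = axis j 1" for j
    by (rule surj_f_inv_f[OF coframing_surj(2)[OF assms]])
  then show thesis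
    by (intro that[of "\<lambda>j. inv ?W (axis j 1)"]) (auto simp: vec_eq_iff axis_def)
qed

text \<open>Tangent vectors of the surface are killed by \<open>\<omega> 3\<close>, and the full
  coframe separates vectors, so the first two forms alone separate them. Two functionals separating
  the vectors of a plane have a dual basis.\<close>

lemma integral_surface_dual_vector:
  assumes cof: "coframing atl \<omega>" and M: "smooth_manifold M atl"
    and surf: "integral_surface M atl (\<omega> 3) \<Sigma> btl \<iota>"
    and b: "b \<in> btl" "p \<in> fst b"
  obtains e where "\<And>i j. pullback atl \<iota> (\<omega> (tang i)) b p (e j) = (if i = j then 1 else 0)"
proof -
  define c where "c = chart_at atl (\<iota> p)"
  define D where "D = frechet_derivative (local_rep b c \<iota>) (at (snd b p))"
  have imm: "immersion \<Sigma> btl M atl \<iota>" and "smooth_manifold \<Sigma> btl"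
    using surf by (auto simp: integral_surface_def)
  then have "p \<in> topspace \<Sigma>"
    using b unfolding smooth_manifold_def by blast
  then have "\<iota> p \<in> topspace M"
    using imm by (auto simp: immersion_def continuous_map_def)
  \<comment> \<open>\<open>chart_at\<close> is a choice operator: only the existence of a chart
    around \<open>\<iota> p\<close> makes the chosen \<open>c\<close> one.\<close>
  then have "\<exists>c. c \<in> atl \<and> \<iota> p \<in> fst c"
    using M unfolding smooth_manifold_def by blast
  then have c: "c \<in> atl" "\<iota> p \<in> fst c"
    unfolding c_def chart_at_def by (metis (mono_tags, lifting) someI_ex)+
  have "smooth_on (snd b ` {p \<in> fst b. \<iota> p \<in> fst c}) (local_rep b c \<iota>)" and "inj D"
    using imm b c by (auto simp: immersion_def D_def)
  \<comment> \<open>Level 1 of smoothness gives differentiability, without which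
    \<open>frechet_derivative\<close> need not be linear.\<close>
  then have "C_k_on (Suc 0) (snd b ` {p \<in> fst b. \<iota> p \<in> fst c}) (local_rep b c \<iota>)"
    unfolding smooth_on_def by blast
  then have "local_rep b c \<iota> differentiable (at (snd b p))"
    using b c by auto
  then have "linear D"
    unfolding D_def by (rule linear_frechet_derivative)
  let ?W = "\<lambda>v. \<chi> i. \<omega> i c (\<iota> p) v"
  have pb: "pullback atl \<iota> \<alpha> b p v = \<alpha> c (\<iota> p) (D v)" for \<alpha> :: "('a, real^3) form1" and v
    by (simp add: pullback_def Let_def c_def D_def)
  have 3: "\<omega> 3 c (\<iota> p) (D v) = 0" for v
    using surf b pb[of "\<omega> 3"] by (auto simp: integral_surface_def)
  have "linear ?W" "surj ?W"
    using coframing_surj[OF cof c] by auto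
  then have "inj ?W"
    by (rule linear_surjective_imp_injective) simp
  define G where "G v = (\<chi> i. \<omega> (tang i) c (\<iota> p) (D v))" for v
  have linW: "linear (\<omega> i c (\<iota> p))" for i
    using cof c by (auto simp: coframing_def one_form_def)
  have "linear G"
    unfolding G_def using \<open>linear D\<close> linW
    by (intro linearI) (auto simp: vec_eq_iff linear_add linear_cmul)
  moreover have "inj G"
  proof (rule injI)
    fix u v
    assume "G u = G v"
    then have "?W (D u) = ?W (D v)"
      using 3 by (auto simp: G_def vec_eq_iff forall_2 forall_3 tang_def)
    then show "u = v"
      using injD[OF \<open>inj ?W\<close>] injD[OF \<open>inj D\<close>] by blast
  qed
  ultimately have "surj G"
    by (rule linear_injective_imp_surjective) simp
  then have "G (inv G (axis j 1)) = axis j 1" for j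
    by (rule surj_f_inv_f)
  then show thesis
    by (intro that[of "\<lambda>j. inv G (axis j 1)"]) (auto simp: vec_eq_iff axis_def G_def pb)
qed

text \<open>The matrix of the \<Gamma> coefficients satisfies the description by definition of the
  second fundamental form. It is the only one, since in a single chart the dual basis of the surface
  already recovers every entry of \<open>S\<close>.\<close>

lemma shape_matrix_eq:
  assumes "coframing atl \<omega>" "smooth_manifold M atl"
    and surf: "integral_surface M atl (\<omega> 3) \<Sigma> btl \<iota>"
    and p: "p \<in> topspace \<Sigma>"
  shows "shape_matrix atl \<omega> \<Gamma> btl \<iota> p = (\<chi> i j. \<Gamma> 3 (tang i) (tang j) (\<iota> p))"
  unfolding shape_matrix_def
proof (rule the_equality)
  fix S :: "real^2^2"
  assume S: "\<forall>b\<in>btl. p \<in> fst b \<longrightarrow> (\<forall>u v.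
        second_fundamental_form atl \<omega> \<Gamma> \<iota> b p u v =
        (\<Sum>i\<in>UNIV. \<Sum>j\<in>UNIV. S $ i $ j *
           pullback atl \<iota> (\<omega> (tang i)) b p u * pullback atl \<iota> (\<omega> (tang j)) b p v))"
  obtain b where b: "b \<in> btl" "p \<in> fst b"
    using surf p unfolding integral_surface_def smooth_manifold_def by blast
  obtain e where e: "\<And>i j. pullback atl \<iota> (\<omega> (tang i)) b p (e j) = (if i = j then 1 else 0)"
    using integral_surface_dual_vector[OF assms(1-3) b] by blast
  have sel: "(\<Sum>i\<in>UNIV. \<Sum>j\<in>UNIV. T i j * pullback atl \<iota> (\<omega> (tang i)) b p (e k)
      * pullback atl \<iota> (\<omega> (tang j)) b p (e l)) = T k l" for T :: "2 \<Rightarrow> 2 \<Rightarrow> real" and k l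
    using exhaust_2[of k] exhaust_2[of l] by (auto simp: e sum_2)
  show "S = (\<chi> i j. \<Gamma> 3 (tang i) (tang j) (\<iota> p))"
  proof (clarsimp simp: vec_eq_iff)
    fix k l
    show "S $ k $ l = \<Gamma> 3 (tang k) (tang l) (\<iota> p)"
      using S b sel[of "\<lambda>i j. S $ i $ j" k l]
        sel[of "\<lambda>i j. \<Gamma> 3 (tang i) (tang j) (\<iota> p)" k l]
      by (simp add: second_fundamental_form_def)
  qed
qed (simp add: second_fundamental_form_def)

text \<open>The coefficient \<open>\<Gamma> i j k\<close> is the value of the connection form on
  \<open>e k\<close>; evaluating the torsion-free equation on \<open>e k\<close> and
  \<open>e l\<close> leaves only the summands with \<open>j = l\<close> and
  \<open>j = k\<close>.\<close>

lemma structure_equation_coefficients: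
  assumes LC: "Levi_Civita_coefficients atl g \<omega> \<Gamma>" and c: "c \<in> atl" "q \<in> fst c"
    and e: "\<And>i j. \<omega> i c q (e j) = (if i = j then 1 else 0)"
  shows "d_form (\<omega> i) c q (e k) (e l) = \<Gamma> i k l q - \<Gamma> i l k q"
    and "\<Gamma> i j k q = - \<Gamma> j i k q"
proof -
  have con: "connection_form \<omega> \<Gamma> i j c q (e k) = \<Gamma> i j k q" for i j k
    by (simp add: connection_form_def e if_distrib cong: if_cong)
  show "\<Gamma> i j k q = - \<Gamma> j i k q"
    using LC c con unfolding Levi_Civita_coefficients_def by metis
  have "d_form (\<omega> i) c q (e k) (e l) =
      - (\<Sum>j\<in>UNIV. (connection_form \<omega> \<Gamma> i j \<and>\<^sub>w \<omega> j) c q (e k) (e l))"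
    using LC c unfolding Levi_Civita_coefficients_def by blast
  also have "\<dots> = \<Gamma> i k l q - \<Gamma> i l k q"
    using exhaust_3[of k] exhaust_3[of l] by (auto simp: wedge_def con e sum_3)
  finally show "d_form (\<omega> i) c q (e k) (e l) = \<Gamma> i k l q - \<Gamma> i l k q" .
qed

theorem proposition11:
  fixes M :: "'m topology" and atl :: "('m, real^3) chart set"
    and \<omega> :: "3 \<Rightarrow> ('m, real^3) form1"
    and A1 A2 A3 C C3 \<zeta> :: "'m \<Rightarrow> real" and \<epsilon> \<delta> :: real
    and \<Gamma> :: "3 \<Rightarrow> 3 \<Rightarrow> 3 \<Rightarrow> 'm \<Rightarrow> real"
    and \<Sigma> :: "'s topology" and btl :: "('s, real^2) chart set" and \<iota> :: "'s \<Rightarrow> 'm"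
  assumes "smooth_manifold M atl"
    and "coframing atl \<omega>"
    and "smooth_fun atl A1" "smooth_fun atl A2" "smooth_fun atl A3"
    and "smooth_fun atl C" "smooth_fun atl C3" "smooth_fun atl \<zeta>"
    and "\<epsilon> \<in> {1, -1}" and "\<delta> \<in> {1, -1}"
    and "\<And>c p u v. c \<in> atl \<Longrightarrow> p \<in> fst c \<Longrightarrow>
      d_form (\<omega> 1) c p u v =
        A2 p * (\<omega> 1 \<and>\<^sub>w \<omega> 2) c p u v + (A3 p - C p) * (\<omega> 1 \<and>\<^sub>w \<omega> 3) c p u v
        + (\<omega> 2 \<and>\<^sub>w \<omega> 3) c p u v"
    and "\<And>c p u v. c \<in> atl \<Longrightarrow> p \<in> fst c \<Longrightarrow>
      d_form (\<omega> 2) c p u v =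
        - A1 p * (\<omega> 1 \<and>\<^sub>w \<omega> 2) c p u v + \<epsilon> * (\<omega> 1 \<and>\<^sub>w \<omega> 3) c p u v
        + (A3 p + C p) * (\<omega> 2 \<and>\<^sub>w \<omega> 3) c p u v"
    and "\<And>c p u v. c \<in> atl \<Longrightarrow> p \<in> fst c \<Longrightarrow>
      d_form (\<omega> 3) c p u v =
        \<delta> * sin (\<zeta> p) * (\<omega> 1 \<and>\<^sub>w \<omega> 3) c p u v + cos (\<zeta> p) * (\<omega> 2 \<and>\<^sub>w \<omega> 3) c p u v"
    and "\<And>c p v. c \<in> atl \<Longrightarrow> p \<in> fst c \<Longrightarrow> d_fun C c p v = C3 p * \<omega> 3 c p v"
    and "\<And>p. p \<in> topspace M \<Longrightarrow> C3 p \<noteq> 0"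
    and "\<And>c p. c \<in> atl \<Longrightarrow> p \<in> fst c \<Longrightarrow> \<exists>u v. (d_fun C \<and>\<^sub>w d_fun C3) c p u v \<noteq> 0"
    and "Levi_Civita_coefficients atl (coframe_metric \<omega>) \<omega> \<Gamma>"
    and "integral_surface M atl (\<omega> 3) \<Sigma> btl \<iota>"
  shows "\<forall>p\<in>topspace \<Sigma>.
           mean_curvature atl \<omega> \<Gamma> btl \<iota> p = A3 (\<iota> p) \<and>
           Gauss_curvature atl \<omega> \<Gamma> btl \<iota> p = (A3 (\<iota> p))\<^sup>2 - (C (\<iota> p))\<^sup>2 - (1 + \<epsilon>) / 2"
proof
  fix p
  assume p: "p \<in> topspace \<Sigma>"
  define q where "q = \<iota> p"
  have "q \<in> topspace M"
    using assms(18) p unfolding q_def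
    by (auto simp: integral_surface_def immersion_def continuous_map_def)
  then obtain c where c: "c \<in> atl" "q \<in> fst c"
    using assms(1) unfolding smooth_manifold_def by blast
  obtain e where e: "\<And>i j. \<omega> i c q (e j) = (if i = j then 1 else 0)"
    using coframing_dual_vector[OF assms(2) c] by blast
  note d = structure_equation_coefficients(1)[OF assms(17) c e]
  note skew = structure_equation_coefficients(2)[OF assms(17) c e]
  have diag: "\<Gamma> i i k q = 0" for i k
    using skew[of i i k] by simp
  \<comment> \<open>The first coefficient vanishes by \<open>diag\<close>, and skewness turns the
    second term into \<open>\<Gamma> 3 1 1\<close>; the indices 2, 2, 3 work alike.\<close>
  have "\<Gamma> 1 1 3 q - \<Gamma> 1 3 1 q = A3 q - C q"
    using d[of 1 1 3] by (simp add: assms(11)[OF c] wedge_def e)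
  then have G11: "\<Gamma> 3 1 1 q = A3 q - C q"
    using skew[of 1 3 1] by (simp add: diag)
  have "\<Gamma> 2 2 3 q - \<Gamma> 2 3 2 q = A3 q + C q"
    using d[of 2 2 3] by (simp add: assms(12)[OF c] wedge_def e)
  then have G22: "\<Gamma> 3 2 2 q = A3 q + C q"
    using skew[of 2 3 2] by (simp add: diag)
  \<comment> \<open>With x, a, b for \<open>\<Gamma> 1 2 3\<close>, \<open>\<Gamma> 3 1 2\<close>,
    \<open>\<Gamma> 3 2 1\<close>, skewness makes the next three equations x + a = 1, b - x =
    \<epsilon> and a = b. The last one is the symmetry of the second fundamental form, which
    expresses the integrability of \<open>\<omega> 3\<close>.\<close>
  have "\<Gamma> 1 2 3 q - \<Gamma> 1 3 2 q = 1"
    using d[of 1 2 3] by (simp add: assms(11)[OF c] wedge_def e)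
  moreover have "\<Gamma> 2 1 3 q - \<Gamma> 2 3 1 q = \<epsilon>"
    using d[of 2 1 3] by (simp add: assms(12)[OF c] wedge_def e)
  moreover have "\<Gamma> 3 1 2 q - \<Gamma> 3 2 1 q = 0"
    using d[of 3 1 2] by (simp add: assms(13)[OF c] wedge_def e)
  ultimately have G12: "\<Gamma> 3 1 2 q = (1 + \<epsilon>) / 2" and G21: "\<Gamma> 3 2 1 q = (1 + \<epsilon>) / 2"
    using skew[of 1 2 3] skew[of 1 3 2] skew[of 2 3 1] by simp_all
  have S: "shape_matrix atl \<omega> \<Gamma> btl \<iota> p = (\<chi> i j. \<Gamma> 3 (tang i) (tang j) q)"
    using shape_matrix_eq[OF assms(2,1,18) p] by (simp add: q_def)
  \<comment> \<open>C cancels in the trace, which is 2 \<open>A3 q\<close>; the average of the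
    principal curvatures is therefore \<open>A3 q\<close>.\<close>
  have "mean_curvature atl \<omega> \<Gamma> btl \<iota> p = A3 q"
    by (simp add: mean_curvature_def S trace_def sum_2 tang_def G11 G22)
  \<comment> \<open>This is the extrinsic determinant, with no contribution from the curvature of
    the ambient metric.\<close>
  moreover have "Gauss_curvature atl \<omega> \<Gamma> btl \<iota> p =
      (A3 q - C q) * (A3 q + C q) - (1 + \<epsilon>) / 2 * ((1 + \<epsilon>) / 2)"
    by (simp add: Gauss_curvature_def S det_2 tang_def G11 G12 G21 G22)
  moreover have "(1 + \<epsilon>) / 2 * ((1 + \<epsilon>) / 2) = (1 + \<epsilon>) / 2"
    using assms(9) by (elim insertE) simp_all
  moreover have "(A3 q - C q) * (A3 q + C q) = (A3 q)\<^sup>2 - (C q)\<^sup>2"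
    by (simp add: power2_eq_square algebra_simps)
  ultimately show "mean_curvature atl \<omega> \<Gamma> btl \<iota> p = A3 (\<iota> p) \<and>
      Gauss_curvature atl \<omega> \<Gamma> btl \<iota> p = (A3 (\<iota> p))\<^sup>2 - (C (\<iota> p))\<^sup>2 - (1 + \<epsilon>) / 2"
    unfolding q_def by metis
qed

end
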